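(* For every integer $n\ge 1$, $$\mathrm{rank}_{\mathbb{Q}}M(n)\le\frac{n^3+n+2}{2}.$$ In other words, if $m>\frac{n^3+n+2}{2}$ and $\tau(1),\tau(2),\dots,\tau(m)$ are $m$ distinct partitions of $n$, then there exist rational numbers $\alpha_1,\alpha_2,\dots,\alpha_m$, not all of them zero, such that for every $y=0,1,2,\dots$, $$\sum_{i=1}^m\alpha_i\, c(\tau(i),y)$$ is the zero polynomial in $q$. In particular, if $p(n)>\frac{n^3+n+2}{2}$, which is true for every $n\ge n_0$ for some $n_0$, then it is not the case that only the trivial rational linear combination of the sequences $c(\tau)$, $\tau\vdash n$, is identically zero: there exist rational numbers $\alpha_\tau$ $(\tau\vdash n)$, not all zero, such that $\sum_{\tau\vdash n}\alpha_\tau\, c(\tau,y)$ is the zero polynomial in $q$ for every $y=0,1,2,\dots$.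
   Context: A partition $\tau\vdash n$ of a positive integer $n$ is a sequence $\tau=(n_1\ge n_2\ge\dots\ge n_k)$ of positive integers with sum $n$; $p(n)$ denotes the number of partitions of $n$. For $\tau=(n_1\ge\dots\ge n_k)\vdash n$ and an integer $y\ge 0$, define the polynomial in $q$ $$c(\tau,y)=\prod_{i=1}^k\left(q^{n_iy}+q^{n_i(y-1)}+\dots+q^{n_i}+1\right),$$ and let $c(\tau)=(c(\tau,y))_{y=0,1,2,\dots}$ be the resulting infinite sequence of polynomials in $q$. Let $M(n)=(c(\tau,y))_{\tau,y}$ be the matrix with $p(n)$ rows indexed by the partitions $\tau$ of $n$ and infinitely many columns indexed by the integers $y\ge 0$. Its rank over $\mathbb{Q}$, $\mathrm{rank}_{\mathbb{Q}}M(n)$, is the maximum number of rows (sequences of polynomials in $q$) that are linearly independent over the field $\mathbb{Q}$. *)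

theory Defs
  imports "HOL-Computational_Algebra.Polynomial" "HOL-Library.Function_Algebras"
begin

definition partitions :: "nat \<Rightarrow> nat list set" where
  "partitions n = {\<tau>. sorted_wrt (\<ge>) \<tau> \<and> (\<forall>k\<in>set \<tau>. 0 < k) \<and> sum_list \<tau> = n}"

definition num_partitions :: "nat \<Rightarrow> nat" where
  "num_partitions n = card (partitions n)"

definition c_seq :: "nat list \<Rightarrow> nat \<Rightarrow> rat poly" where
  "c_seq \<tau> y = (\<Prod>k\<leftarrow>\<tau>. \<Sum>j\<le>y. monom 1 (k * j))"

definition scale_seq :: "rat \<Rightarrow> (nat \<Rightarrow> rat poly) \<Rightarrow> nat \<Rightarrow> rat poly" where
  "scale_seq a f = (\<lambda>y. smult a (f y))"

interpretation seq: vector_space scale_seq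
  by unfold_locales
    (simp_all add: scale_seq_def fun_eq_iff smult_add_right smult_add_left)

text \<open>A matrix with rows indexed by a finite set \<open>I\<close> and columns indexed by the natural
  numbers is given by its family of rows. Linear independence is that of the family: the selected
  rows are pairwise distinct and form an independent set over the rationals.\<close>

definition row_rank :: "'i set \<Rightarrow> ('i \<Rightarrow> nat \<Rightarrow> rat poly) \<Rightarrow> nat" where
  "row_rank I M = Max {card S | S. S \<subseteq> I \<and> inj_on M S \<and> seq.independent (M ` S)}"

definition rank_M :: "nat \<Rightarrow> nat" where
  "rank_M n = row_rank (partitions n) c_seq"

lemma finite_partitions: "finite (partitions n)"
proof (rule finite_subset)
  show "partitions n \<subseteq> {\<tau>. set \<tau> \<subseteq> {..n} \<and> length \<tau> \<le> n}"
  proof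
    fix \<tau> assume "\<tau> \<in> partitions n"
    then have pos: "\<forall>k\<in>set \<tau>. 0 < k" and sum: "sum_list \<tau> = n"
      by (auto simp: partitions_def)
    have "length \<tau> \<le> sum_list \<tau>"
      using pos by (induction \<tau>) auto
    moreover have "set \<tau> \<subseteq> {..n}"
      using sum member_le_sum_list by fastforce
    ultimately show "\<tau> \<in> {\<tau>. set \<tau> \<subseteq> {..n} \<and> length \<tau> \<le> n}"
      using sum by simp
  qed
qed (rule finite_lists_length_le, simp)

text \<open>The maximum in \<open>row_rank\<close> ranges over a finite nonempty set.\<close>

lemma row_rank_attained:
  assumes "finite I"
  shows "finite {card S | S. S \<subseteq> I \<and> inj_on M S \<and> seq.independent (M ` S)}"
    and "{card S | S. S \<subseteq> I \<and> inj_on M S \<and> seq.independent (M ` S)} \<noteq> {}"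
proof -
  have "{card S | S. S \<subseteq> I \<and> inj_on M S \<and> seq.independent (M ` S)} \<subseteq> card ` Pow I"
    by auto
  then show "finite {card S | S. S \<subseteq> I \<and> inj_on M S \<and> seq.independent (M ` S)}"
    using assms by (meson finite_Pow_iff finite_imageI finite_subset)
  have "card ({} :: 'a set) \<in> {card S | S. S \<subseteq> I \<and> inj_on M S \<and> seq.independent (M ` S)}"
    using seq.independent_empty by force
  then show "{card S | S. S \<subseteq> I \<and> inj_on M S \<and> seq.independent (M ` S)} \<noteq> {}"
    by blast
qed

end

theory Submission
  imports Defs "HOL-Real_Asymp.Real_Asymp"
begin

text \<open>
  With \<open>w = q ^ (y + 1)\<close> one has \<open>c(\<tau>, y) = P\<^sub>\<tau>(w) / P\<^sub>\<tau>(q)\<close>, where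
  \<open>P\<^sub>\<tau>(x) = \<Prod>\<^sub>i (x ^ n\<^sub>i - 1)\<close> has degree \<open>n\<close>. All denominators divide
  \<open>D(q) = \<Prod>\<^sub>j\<^sub>\<le>\<^sub>n (q ^ j - 1)\<close>, which has degree \<open>n (n + 1) / 2\<close>, so the sequences
  \<open>D(q) c(\<tau>, y)\<close> lie in the span of the monomials \<open>w ^ a q ^ b\<close> with \<open>a \<le> n\<close> and
  \<open>b \<le> n (n - 1) / 2\<close>. There are \<open>(n + 1) (n (n - 1) / 2 + 1) = (n ^ 3 + n + 2) / 2\<close> of these.
\<close>

section \<open>Linear dependence of indexed families\<close>

text \<open>Coefficients belong to indices, not to vectors, so a repetition in the family is already
  a dependence. Without repetitions, an independent image inside the span of \<open>B\<close> would
  have at most \<open>card B\<close> elements.\<close>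

lemma (in vector_space) dependent_family_in_span:
  assumes "finite I" "finite B" "f ` I \<subseteq> span B" "card B < card I"
  shows "\<exists>\<alpha>. (\<exists>i\<in>I. \<alpha> i \<noteq> 0) \<and> (\<Sum>i\<in>I. scale (\<alpha> i) (f i)) = 0"
proof (cases "inj_on f I")
  case True
  have "dependent (f ` I)"
  proof (rule ccontr)
    assume "independent (f ` I)"
    with assms have "card (f ` I) \<le> card B"
      using independent_span_bound by blast
    with True assms(4) show False
      by (simp add: card_image)
  qed
  with assms(1) obtain u where u: "\<exists>v\<in>f ` I. u v \<noteq> 0" "(\<Sum>v\<in>f ` I. scale (u v) v) = 0"
    by (auto simp: dependent_finite)
  then show ?thesis
    using True by (intro exI[of _ "u \<circ> f"]) (auto simp: sum.reindex)
next
  case False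
  then obtain i j where ij: "i \<in> I" "j \<in> I" "i \<noteq> j" "f i = f j"
    by (auto simp: inj_on_def)
  \<comment> \<open>Two equal members cancel with coefficients 1 and -1.\<close>
  define \<alpha> :: "_ \<Rightarrow> 'a" where "\<alpha> k = (if k = i then 1 else if k = j then -1 else 0)" for k
  have "(\<Sum>k\<in>I. scale (\<alpha> k) (f k)) = (\<Sum>k\<in>{i, j}. scale (\<alpha> k) (f k))"
    using ij assms(1) by (intro sum.mono_neutral_right) (auto simp: \<alpha>_def)
  also have "\<dots> = 0"
    using ij by (simp add: \<alpha>_def)
  finally show ?thesis
    using ij(1) by (intro exI[of _ \<alpha>]) (auto simp: \<alpha>_def)
qed

lemma sum_fun_apply: "(\<Sum>i\<in>A. f i) x = (\<Sum>i\<in>A. f i x)"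
  by (induction A rule: infinite_finite_induct) simp_all

section \<open>The polynomials \<open>q ^ k - 1\<close> and their products\<close>

definition pow_minus_1 :: "nat \<Rightarrow> rat poly" where
  "pow_minus_1 k = monom 1 k - 1"

definition partition_poly :: "nat list \<Rightarrow> rat poly" where
  "partition_poly \<tau> = (\<Prod>k\<leftarrow>\<tau>. pow_minus_1 k)"

definition common_denom :: "nat \<Rightarrow> rat poly" where
  "common_denom n = (\<Prod>j\<in>{1..n}. pow_minus_1 j)"

text \<open>The case \<open>k = 0\<close> fits because the zero polynomial has degree 0 by
  convention.\<close>

lemma degree_pow_minus_1 [simp]: "degree (pow_minus_1 k) = k"
proof (cases "k = 0")
  case False
  then have "degree (monom (1::rat) k + (-1)) = degree (monom (1::rat) k)"
    by (intro degree_add_eq_left) (simp add: degree_monom_eq)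
  then show ?thesis
    by (simp add: pow_minus_1_def degree_monom_eq)
qed (simp add: pow_minus_1_def)

lemma pow_minus_1_eq_0_iff [simp]: "pow_minus_1 k = 0 \<longleftrightarrow> k = 0"
proof
  show "k = 0" if "pow_minus_1 k = 0"
    using degree_pow_minus_1[of k] that by simp
qed (simp add: pow_minus_1_def)

text \<open>Telescoping geometric series with ratio \<open>q ^ k\<close>, kept free of division so
  that all work stays in the polynomial ring.\<close>

lemma geometric_sum_times_pow_minus_1:
  "(\<Sum>j\<le>y. monom 1 (k * j)) * pow_minus_1 k = pow_minus_1 (k * Suc y)"
  by (induction y) (simp_all add: pow_minus_1_def algebra_simps mult_monom)

lemma pow_minus_1_dvd: "k dvd m \<Longrightarrow> pow_minus_1 k dvd pow_minus_1 m"
proof (elim dvdE)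
  fix l assume l: "m = k * l"
  show ?thesis
  proof (cases l)
    \<comment> \<open>The geometric sum has at least one term and so reaches only positive
      multipliers; the multiplier 0 gives the zero polynomial, divisible by everything.\<close>
    case 0
    then show ?thesis
      by (simp add: l pow_minus_1_def)
  next
    case (Suc y)
    then show ?thesis
      unfolding l by (metis geometric_sum_times_pow_minus_1 dvd_triv_right)
  qed
qed

lemma pcompose_pow_minus_1: "pcompose (pow_minus_1 k) (monom 1 m) = pow_minus_1 (k * m)"
proof -
  have "pcompose (monom 1 k) (monom (1::rat) m) = monom 1 (k * m)"
    by (induction k) (simp_all add: monom_0 monom_Suc pcompose_pCons mult_monom)
  then show ?thesis
    by (simp add: pow_minus_1_def pcompose_diff pcompose_1)
qed

text \<open>The quotient formula for \<open>c_seq\<close> with its denominator cleared: composition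
  with \<open>monom 1 (Suc y)\<close> substitutes \<open>w\<close> for \<open>q\<close>, and each
  part contributes one geometric series.\<close>

lemma c_seq_times_partition_poly:
  "c_seq \<tau> y * partition_poly \<tau> = pcompose (partition_poly \<tau>) (monom 1 (Suc y))"
proof (induction \<tau>)
  case (Cons k \<tau>)
  have "c_seq (k # \<tau>) y * partition_poly (k # \<tau>) =
    ((\<Sum>j\<le>y. monom 1 (k * j)) * pow_minus_1 k) * (c_seq \<tau> y * partition_poly \<tau>)"
    by (simp add: c_seq_def partition_poly_def mult_ac)
  also have "\<dots> = pcompose (partition_poly (k # \<tau>)) (monom 1 (Suc y))"
    unfolding geometric_sum_times_pow_minus_1 Cons
    by (simp add: partition_poly_def pcompose_mult pcompose_pow_minus_1)
  finally show ?case .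
qed (simp add: c_seq_def partition_poly_def pcompose_1)

lemma partition_poly_nonzero: "\<forall>k\<in>set \<tau>. 0 < k \<Longrightarrow> partition_poly \<tau> \<noteq> 0"
  by (force simp: partition_poly_def prod_list_zero_iff)

lemma degree_partition_poly:
  "\<forall>k\<in>set \<tau>. 0 < k \<Longrightarrow> degree (partition_poly \<tau>) = sum_list \<tau>"
proof (induction \<tau>)
  case (Cons k \<tau>)
  then show ?case
    using degree_mult_eq[OF _ partition_poly_nonzero, of "pow_minus_1 k" \<tau>]
    by (simp add: partition_poly_def)
qed (simp add: partition_poly_def)

lemma common_denom_nonzero: "common_denom n \<noteq> 0"
  by (simp add: common_denom_def)

lemma degree_common_denom: "degree (common_denom n) = n * (n + 1) div 2"
proof -
  have "degree (common_denom n) = (\<Sum>j\<in>{1..n}. j)"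
    unfolding common_denom_def
    by (subst degree_prod_eq_sum_degree) auto
  also have "\<dots> = n * (n + 1) div 2"
    using gauss_sum_from_Suc_0[where 'a = nat, of n] by simp
  finally show ?thesis .
qed

text \<open>Among any \<open>k\<close> consecutive exponents one is a multiple of \<open>k\<close>.\<close>

lemma partition_poly_dvd_common_denom:
  "\<forall>k\<in>set \<tau>. 0 < k \<Longrightarrow> partition_poly \<tau> dvd common_denom (sum_list \<tau>)"
proof (induction \<tau>)
  case (Cons k \<tau>)
  define s where "s = sum_list \<tau>"
  have k: "0 < k" using Cons.prems by simp
  \<comment> \<open>The least multiple of \<open>k\<close> above \<open>s\<close>. It lies among the
    \<open>k\<close> new exponents by which the common denominator grows when the part
    \<open>k\<close> is added.\<close>
  define j where "j = k * (s div k + 1)"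
  have "j = s - s mod k + k"
    by (simp add: j_def algebra_simps minus_mod_eq_mult_div)
  moreover have "s mod k < k" "s mod k \<le> s"
    using k by simp_all
  ultimately have "j \<in> {s+1..s+k}"
    by auto
  then have "pow_minus_1 j dvd (\<Prod>i\<in>{s+1..s+k}. pow_minus_1 i)"
    by (intro dvd_prodI) auto
  moreover have "pow_minus_1 k dvd pow_minus_1 j"
    by (intro pow_minus_1_dvd) (simp add: j_def)
  ultimately have "pow_minus_1 k dvd (\<Prod>i\<in>{s+1..s+k}. pow_minus_1 i)"
    by (rule dvd_trans[rotated])
  moreover have "partition_poly \<tau> dvd common_denom s"
    using Cons by (simp add: s_def)
  moreover have "common_denom (s + k) = common_denom s * (\<Prod>i\<in>{s+1..s+k}. pow_minus_1 i)"
    unfolding common_denom_def by (rule prod.ub_add_nat) simp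
  ultimately show ?case
    by (simp add: partition_poly_def s_def add.commute mult_dvd_mono mult.commute[of "pow_minus_1 k"])
qed (simp add: partition_poly_def common_denom_def)

section \<open>The spanning monomial sequences\<close>

text \<open>The exponent is that of \<open>w ^ a * q ^ b\<close> with
  \<open>w = q ^ (y + 1)\<close>.\<close>

definition monom_seq :: "nat \<times> nat \<Rightarrow> nat \<Rightarrow> rat poly" where
  "monom_seq = (\<lambda>(a, b) y. monom 1 (Suc y * a + b))"

definition monom_seqs :: "nat \<Rightarrow> (nat \<Rightarrow> rat poly) set" where
  "monom_seqs n = monom_seq ` ({..n} \<times> {..n * (n - 1) div 2})"

lemma finite_monom_seqs: "finite (monom_seqs n)"
  by (simp add: monom_seqs_def)

lemma card_monom_seqs: "real (card (monom_seqs n)) \<le> (real n ^ 3 + real n + 2) / 2"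
proof -
  have "card (monom_seqs n) \<le> (n + 1) * (n * (n - 1) div 2 + 1)"
    unfolding monom_seqs_def
    by (rule order.trans[OF card_image_le]) (simp_all add: card_cartesian_product)
  then have "real (card (monom_seqs n)) \<le> real ((n + 1) * (n * (n - 1) div 2 + 1))"
    by (simp only: of_nat_le_iff)
  also have "\<dots> = (real n + 1) * (real (n * (n - 1) div 2) + 1)"
    by (simp only: of_nat_mult of_nat_add of_nat_1)
  \<comment> \<open>The division is exact, since one of two consecutive integers is even.\<close>
  also have "real (n * (n - 1) div 2) = real (n * (n - 1)) / 2"
    using real_of_nat_div[of 2 "n * (n - 1)"] by auto
  also have "(real n + 1) * (real (n * (n - 1)) / 2 + 1) = (real n ^ 3 + real n + 2) / 2"
    by (cases n) (simp_all add: field_simps power3_eq_cube)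
  finally show ?thesis .
qed

text \<open>If the common denominator is \<open>P * Q\<close>, clearing it turns
  \<open>c_seq\<close> into \<open>P(w) * Q(q)\<close>, where \<open>Q\<close> has degree
  \<open>n (n + 1) / 2 - n = n (n - 1) / 2\<close>.\<close>

lemma common_denom_times_c_seq_in_span:
  assumes "\<tau> \<in> partitions n"
  shows "(\<lambda>y. common_denom n * c_seq \<tau> y) \<in> seq.span (monom_seqs n)"
proof -
  define P where "P = partition_poly \<tau>"
  define m where "m = n * (n - 1) div 2"
  have pos: "\<forall>k\<in>set \<tau>. 0 < k" and sum: "sum_list \<tau> = n"
    using assms by (auto simp: partitions_def)
  have "P \<noteq> 0" and degP: "degree P = n"
    using partition_poly_nonzero degree_partition_poly pos sum by (simp_all add: P_def)
  obtain Q where Q: "common_denom n = P * Q"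
    using partition_poly_dvd_common_denom[OF pos] sum by (auto simp: P_def elim: dvdE)
  then have "Q \<noteq> 0"
    using common_denom_nonzero[of n] by auto
  then have "n + degree Q = n * (n + 1) div 2"
    using degree_common_denom[of n] \<open>P \<noteq> 0\<close> degP by (simp add: Q degree_mult_eq)
  moreover have "n * (n + 1) div 2 = m + n"
    unfolding m_def by (cases n) (simp_all add: algebra_simps)
  ultimately have degQ: "degree Q = m"
    by simp
  \<comment> \<open>The coefficients do not depend on \<open>y\<close>, so these identities for
    single columns combine into one linear relation between sequences.\<close>
  have "common_denom n * c_seq \<tau> y =
    (\<Sum>(a, b)\<in>{..n} \<times> {..m}. smult (coeff P a * coeff Q b) (monom_seq (a, b) y))" for y
  proof -
    have "common_denom n * c_seq \<tau> y = pcompose P (monom 1 (Suc y)) * Q"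
      using c_seq_times_partition_poly[of \<tau> y] by (simp add: Q P_def mult_ac)
    also have "pcompose P (monom 1 (Suc y)) = (\<Sum>a\<le>n. smult (coeff P a) (monom 1 (Suc y * a)))"
      by (simp add: pcompose_altdef poly_altdef degP degree_map_poly coeff_map_poly monom_power)
    also have "Q = (\<Sum>b\<le>m. smult (coeff Q b) (monom 1 b))"
      using poly_as_sum_of_monoms[of Q] by (simp add: degQ smult_monom)
    finally show ?thesis
      by (simp add: sum_product sum.cartesian_product mult_monom smult_monom monom_seq_def split_def)
  qed
  then have "(\<lambda>y. common_denom n * c_seq \<tau> y) =
    (\<Sum>p\<in>{..n} \<times> {..m}. scale_seq (coeff P (fst p) * coeff Q (snd p)) (monom_seq p))"
    by (simp add: fun_eq_iff sum_fun_apply scale_seq_def split_def)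
  also have "\<dots> \<in> seq.span (monom_seqs n)"
    by (intro seq.span_sum seq.span_scale seq.span_base) (auto simp: monom_seqs_def m_def)
  finally show ?thesis .
qed

section \<open>Dependence of the rows and the rank bound\<close>

text \<open>The factor \<open>common_denom n\<close> is the same for all rows and nonzero, so it
  cancels from any relation between the scaled rows.\<close>

lemma c_seq_family_dependent:
  assumes "finite I" "\<tau> ` I \<subseteq> partitions n" "(real n ^ 3 + real n + 2) / 2 < real (card I)"
  shows "\<exists>\<alpha>. (\<exists>i\<in>I. \<alpha> i \<noteq> 0) \<and> (\<forall>y. (\<Sum>i\<in>I. smult (\<alpha> i) (c_seq (\<tau> i) y)) = 0)"
proof -
  have "card (monom_seqs n) < card I"
    using card_monom_seqs[of n] assms(3) by linarith
  moreover have "(\<lambda>i y. common_denom n * c_seq (\<tau> i) y) ` I \<subseteq> seq.span (monom_seqs n)"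
    using common_denom_times_c_seq_in_span assms(2) by blast
  ultimately have "\<exists>\<alpha>. (\<exists>i\<in>I. \<alpha> i \<noteq> 0) \<and>
      (\<Sum>i\<in>I. scale_seq (\<alpha> i) (\<lambda>y. common_denom n * c_seq (\<tau> i) y)) = 0"
    by (intro seq.dependent_family_in_span[OF assms(1) finite_monom_seqs])
  then obtain \<alpha> where \<alpha>: "\<exists>i\<in>I. \<alpha> i \<noteq> 0"
    "(\<Sum>i\<in>I. scale_seq (\<alpha> i) (\<lambda>y. common_denom n * c_seq (\<tau> i) y)) = 0"
    by blast
  have "(\<Sum>i\<in>I. smult (\<alpha> i) (c_seq (\<tau> i) y)) = 0" for y
  proof -
    have "common_denom n * (\<Sum>i\<in>I. smult (\<alpha> i) (c_seq (\<tau> i) y)) = 0"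
      using fun_cong[OF \<alpha>(2), of y] by (simp add: scale_seq_def sum_fun_apply sum_distrib_left)
    then show ?thesis
      using common_denom_nonzero by simp
  qed
  with \<alpha>(1) show ?thesis by blast
qed

lemma rank_M_le: "real (rank_M n) \<le> (real n ^ 3 + real n + 2) / 2"
proof (rule ccontr)
  assume gt: "\<not> ?thesis"
  obtain S where S: "rank_M n = card S" "S \<subseteq> partitions n" "inj_on c_seq S"
      "seq.independent (c_seq ` S)"
    using Max_in[OF row_rank_attained[OF finite_partitions[of n], of c_seq]]
    by (auto simp: rank_M_def row_rank_def)
  have fin: "finite S"
    using S(2) finite_partitions finite_subset by blast
  obtain \<alpha> where \<alpha>: "\<exists>\<tau>\<in>S. \<alpha> \<tau> \<noteq> 0" "\<forall>y. (\<Sum>\<tau>\<in>S. smult (\<alpha> \<tau>) (c_seq \<tau> y)) = 0"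
    using c_seq_family_dependent[OF fin, of "\<lambda>\<tau>. \<tau>" n] gt S by auto
  \<comment> \<open>Carries the coefficients from partitions to rows, as independence of a set of
    vectors requires.\<close>
  define u where "u = \<alpha> \<circ> the_inv_into S c_seq"
  have u: "u (c_seq \<tau>) = \<alpha> \<tau>" if "\<tau> \<in> S" for \<tau>
    using that S(3) by (simp add: u_def the_inv_into_f_f)
  have "(\<Sum>v\<in>c_seq ` S. scale_seq (u v) v) = 0"
    using \<alpha>(2) S(3) by (simp add: sum.reindex u fun_eq_iff sum_fun_apply scale_seq_def)
  moreover have "\<exists>v\<in>c_seq ` S. u v \<noteq> 0"
    using \<alpha>(1) u by auto
  ultimately show False
    using S(4) seq.dependent_finite[of "c_seq ` S"] fin by blast
qed

section \<open>Growth of the number of partitions\<close>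

text \<open>Multiplicities of the parts 2, 3, 4, 5 may be chosen freely up to
  \<open>n div 14\<close>, because 2 + 3 + 4 + 5 = 14; ones fill up the remainder. Four free
  multiplicities give quartic growth, enough to beat a cubic.\<close>

lemma num_partitions_ge: "(n div 14 + 1) ^ 4 \<le> num_partitions n"
proof -
  define K where "K = {..n div 14}"
  define f :: "nat \<times> nat \<times> nat \<times> nat \<Rightarrow> nat list" where
    "f = (\<lambda>(a, b, c, d). replicate d 5 @ replicate c 4 @ replicate b 3 @ replicate a 2 @
      replicate (n - (2 * a + 3 * b + 4 * c + 5 * d)) 1)"
  have sorted_rep: "sorted_wrt (\<ge>) (replicate m x)" for m and x :: nat
    by (induction m) auto
  have count_rep: "count_list (replicate m x) z = (if x = z then m else 0)" for m and x z :: nat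
    by (induction m) auto
  have "inj_on f (K \<times> K \<times> K \<times> K)"
  proof (rule inj_onI, clarsimp)
    fix a b c d a' b' c' d'
    assume "f (a, b, c, d) = f (a', b', c', d')"
    \<comment> \<open>The multiplicities of 2, 3, 4, 5 in the list recover the quadruple.\<close>
    then have "count_list (f (a, b, c, d)) i = count_list (f (a', b', c', d')) i" for i
      by simp
    from this[of 2] this[of 3] this[of 4] this[of 5]
    show "a = a' \<and> b = b' \<and> c = c' \<and> d = d'"
      by (simp add: f_def count_rep)
  qed
  moreover have "f ` (K \<times> K \<times> K \<times> K) \<subseteq> partitions n"
  proof clarify
    fix a b c d assume "a \<in> K" "b \<in> K" "c \<in> K" "d \<in> K"
    then have "2 * a + 3 * b + 4 * c + 5 * d \<le> n"
      unfolding K_def atMost_iff by linarith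
    then show "f (a, b, c, d) \<in> partitions n"
      by (auto simp: f_def partitions_def sorted_wrt_append sorted_rep sum_list_replicate)
  qed
  ultimately have "card (K \<times> K \<times> K \<times> K) \<le> num_partitions n"
    unfolding num_partitions_def using finite_partitions card_inj_on_le by blast
  moreover have "card (K \<times> K \<times> K \<times> K) = (n div 14 + 1) ^ 4"
    by (simp add: K_def card_cartesian_product power4_eq_xxxx del: mult_Suc mult_Suc_right)
  ultimately show ?thesis
    by simp
qed

lemma eventually_num_partitions_gt:
  "\<forall>\<^sub>F n in sequentially. (real n ^ 3 + real n + 2) / 2 < real (num_partitions n)"
proof -
  have "\<forall>\<^sub>F n in sequentially. (real n ^ 3 + real n + 2) / 2 < (real n / 14) ^ 4"
    by real_asymp
  then show ?thesis
  proof eventually_elim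
    case (elim n)
    \<comment> \<open>The added 1 absorbs the rounding down of the division.\<close>
    have "real n / 14 \<le> real (n div 14 + 1)"
      by linarith
    then have "(real n / 14) ^ 4 \<le> real (n div 14 + 1) ^ 4"
      by (intro power_mono) auto
    also have "\<dots> \<le> real (num_partitions n)"
      using num_partitions_ge[of n] by (simp only: of_nat_power[symmetric] of_nat_le_iff)
    finally show ?case
      using elim by linarith
  qed
qed

theorem proposition1:
  "(\<forall>n\<ge>1. real (rank_M n) \<le> (real n ^ 3 + real n + 2) / 2) \<and>
   (\<forall>n\<ge>1. \<forall>(m::nat) (\<tau> :: nat \<Rightarrow> nat list).
      real m > (real n ^ 3 + real n + 2) / 2 \<longrightarrow>
      inj_on \<tau> {1..m} \<longrightarrow> (\<forall>i\<in>{1..m}. \<tau> i \<in> partitions n) \<longrightarrow>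
      (\<exists>\<alpha> :: nat \<Rightarrow> rat. (\<exists>i\<in>{1..m}. \<alpha> i \<noteq> 0) \<and>
         (\<forall>y. (\<Sum>i=1..m. smult (\<alpha> i) (c_seq (\<tau> i) y)) = 0))) \<and>
   (\<exists>n0. \<forall>n\<ge>n0. real (num_partitions n) > (real n ^ 3 + real n + 2) / 2) \<and>
   (\<forall>n\<ge>1. real (num_partitions n) > (real n ^ 3 + real n + 2) / 2 \<longrightarrow>
      (\<exists>\<alpha> :: nat list \<Rightarrow> rat. (\<exists>\<tau>\<in>partitions n. \<alpha> \<tau> \<noteq> 0) \<and>
         (\<forall>y. (\<Sum>\<tau>\<in>partitions n. smult (\<alpha> \<tau>) (c_seq \<tau> y)) = 0)))"
proof (intro conjI allI impI)
  fix n :: nat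
  show "real (rank_M n) \<le> (real n ^ 3 + real n + 2) / 2"
    by (rule rank_M_le)
next
  fix n m :: nat and \<tau> :: "nat \<Rightarrow> nat list"
  assume "real m > (real n ^ 3 + real n + 2) / 2" "\<forall>i\<in>{1..m}. \<tau> i \<in> partitions n"
  then show "\<exists>\<alpha> :: nat \<Rightarrow> rat. (\<exists>i\<in>{1..m}. \<alpha> i \<noteq> 0) \<and>
      (\<forall>y. (\<Sum>i=1..m. smult (\<alpha> i) (c_seq (\<tau> i) y)) = 0)"
    by (intro c_seq_family_dependent) auto
next
  show "\<exists>n0. \<forall>n\<ge>n0. real (num_partitions n) > (real n ^ 3 + real n + 2) / 2"
    using eventually_num_partitions_gt by (simp add: eventually_sequentially)
next
  fix n :: nat
  assume "real (num_partitions n) > (real n ^ 3 + real n + 2) / 2"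
  then show "\<exists>\<alpha> :: nat list \<Rightarrow> rat. (\<exists>\<tau>\<in>partitions n. \<alpha> \<tau> \<noteq> 0) \<and>
      (\<forall>y. (\<Sum>\<tau>\<in>partitions n. smult (\<alpha> \<tau>) (c_seq \<tau> y)) = 0)"
    using c_seq_family_dependent[of "partitions n" "\<lambda>\<tau>. \<tau>" n]
    by (simp add: finite_partitions num_partitions_def)
qed

end
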